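(* For the scheduling problem without release dates $P|pmtn|f$, where $f$ is any regular (non-decreasing) function of the completion times, non-delay Permutation Flow Shop-like schedules are dominant, up to a renumbering of the jobs. That is, for any instance having an optimal solution, the jobs can be renumbered so that there is an optimal solution that is non-delay and Permutation Flow Shop-like with respect to the new numbering.
   Context: Problem $P|pmtn|f$: there are $n$ independent jobs $1,\dots,n$ and $m$ identical machines $M_1,\dots,M_m$. Job $j$ has processing time $p_j$, and all jobs are available from time $0$. Each machine processes at most one job at a time, and each job is processed by at most one machine at a time. Preemption is allowed: a job may be interrupted and resumed later, possibly on another machine. A solution is a schedule satisfying these constraints in which each job $j$ receives total processing $p_j$; $C_j$ is the completion time of job $j$. The objective is to minimize a regular (i.e. non-decreasing in the completion times) function $f$ of $C_1,\dots,C_n$. A piece of a job is a part of the job that is scheduled without interruption (on one machine). A job $j$ is processed at time $t$ if there is a machine on which a piece of $j$ starts at a time $t_1\le t$ and ends at a time $t_2>t$. $J(t)$ denotes the set of jobs processed at time $t$, and for $j\in J(t)$, $M(j,t)$ denotes the machine processing $j$ at time $t$. Non-delay: a schedule is non-delay if, whenever a machine is idle during a time interval $[t,t+\epsilon[$ ($\epsilon>0$), no piece of length $\epsilon'\le\epsilon$ of a job processed at a time $t'>t$ can be processed at time $t$ (i.e. moved to start at time $t$ in the idle interval while keeping the schedule feasible). Vertically ordered: a schedule is vertically ordered if at any time $t$, when $J(t)=\{j_1,\dots,j_k\}$ with $j_1<j_2<\dots<j_k$ (in the numbering of the jobs), we have $M(j_i,t)=M_i$ for $i=1,\dots,k$.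 Permutation Flow Shop-like: a schedule is Permutation Flow Shop-like if (1) it is vertically ordered; (2) no machine processes more than one piece of each job; (3) the scheduling order on the different machines is the same, i.e. there is a single ordering of the jobs such that each machine processes the jobs it handles in that order (a job need not be processed on every machine). *)

theory Defs
  imports Complex_Main "HOL-Combinatorics.Permutations"
begin

text \<open>
  Jobs are numbered \<open>1, \<dots>, n\<close> and machines \<open>1, \<dots>, m\<close>. An entry \<open>(j, i, s, e)\<close> of a schedule
  says that machine \<open>i\<close> processes job \<open>j\<close> without interruption during \<open>{s..<e}\<close>.
\<close>

type_synonym piece = "nat \<times> nat \<times> real \<times> real"
type_synonym schedule = "piece set"

text \<open>
  Abutting entries of one job on one machine are allowed here: otherwise moving a part of a job
  right next to another part of it would count as infeasible in \<open>non_delay\<close>.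
\<close>

definition feasible :: "nat \<Rightarrow> nat \<Rightarrow> (nat \<Rightarrow> real) \<Rightarrow> schedule \<Rightarrow> bool" where
  "feasible n m p S \<longleftrightarrow>
     finite S \<and>
     (\<forall>(j, i, s, e) \<in> S. j \<in> {1..n} \<and> i \<in> {1..m} \<and> 0 \<le> s \<and> s < e) \<and>
     (\<forall>(j, i, s, e) \<in> S. \<forall>(j', i', s', e') \<in> S.
        (j, i, s, e) \<noteq> (j', i', s', e') \<and> (i = i' \<or> j = j') \<longrightarrow> {s..<e} \<inter> {s'..<e'} = {}) \<and>
     (\<forall>j \<in> {1..n}. (\<Sum>(j', i, s, e) \<in> {q \<in> S. fst q = j}. e - s) = p j)"

definition completion :: "schedule \<Rightarrow> nat \<Rightarrow> real" where
  "completion S j = Max {e. \<exists>i s. (j, i, s, e) \<in> S}"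

text \<open>
  Monotonicity is required on non-negative vectors only, as completion times are non-negative.
  It also forces \<open>f C\<close> to depend only on \<open>C 1, \<dots>, C n\<close>.
\<close>

definition regular :: "nat \<Rightarrow> ((nat \<Rightarrow> real) \<Rightarrow> real) \<Rightarrow> bool" where
  "regular n f \<longleftrightarrow>
     (\<forall>C D. (\<forall>j \<in> {1..n}. 0 \<le> C j \<and> C j \<le> D j) \<longrightarrow> f C \<le> f D)"

definition optimal ::
  "nat \<Rightarrow> nat \<Rightarrow> (nat \<Rightarrow> real) \<Rightarrow> ((nat \<Rightarrow> real) \<Rightarrow> real) \<Rightarrow> schedule \<Rightarrow> bool" where
  "optimal n m p f S \<longleftrightarrow>
     feasible n m p S \<and>
     (\<forall>S'. feasible n m p S' \<longrightarrow> f (completion S) \<le> f (completion S'))"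

definition processed_on :: "schedule \<Rightarrow> nat \<Rightarrow> nat \<Rightarrow> real \<Rightarrow> bool" where
  "processed_on S j i t \<longleftrightarrow> (\<exists>s e. (j, i, s, e) \<in> S \<and> s \<le> t \<and> t < e)"

definition jobs_at :: "schedule \<Rightarrow> real \<Rightarrow> nat set" where
  "jobs_at S t = {j. \<exists>i. processed_on S j i t}"

definition machine_of :: "schedule \<Rightarrow> nat \<Rightarrow> real \<Rightarrow> nat" where
  "machine_of S j t = (THE i. processed_on S j i t)"

definition idle :: "schedule \<Rightarrow> nat \<Rightarrow> real set \<Rightarrow> bool" where
  "idle S i T \<longleftrightarrow> (\<forall>t \<in> T. \<forall>j. \<not> processed_on S j i t)"

text \<open>
  \<open>move S (j, k, s, e) a l i t\<close> takes the part \<open>{a..<a + l}\<close> out of the entry \<open>(j, k, s, e)\<close>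
  and processes it on machine \<open>i\<close> from time \<open>t\<close> on.
\<close>

fun move :: "schedule \<Rightarrow> piece \<Rightarrow> real \<Rightarrow> real \<Rightarrow> nat \<Rightarrow> real \<Rightarrow> schedule" where
  "move S (j, k, s, e) a l i t =
     (S - {(j, k, s, e)})
     \<union> (if s < a then {(j, k, s, a)} else {})
     \<union> (if a + l < e then {(j, k, a + l, e)} else {})
     \<union> {(j, i, t, t + l)}"

text \<open>The part that is moved may be any uninterrupted part of a job, not only a whole entry.\<close>

definition non_delay :: "nat \<Rightarrow> nat \<Rightarrow> (nat \<Rightarrow> real) \<Rightarrow> schedule \<Rightarrow> bool" where
  "non_delay n m p S \<longleftrightarrow>
     (\<forall>i \<in> {1..m}. \<forall>t \<ge> 0. \<forall>\<epsilon> > 0. idle S i {t..<t + \<epsilon>} \<longrightarrow>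
        \<not> (\<exists>j k s e a l. (j, k, s, e) \<in> S \<and> 0 < l \<and> l \<le> \<epsilon> \<and>
             t < a \<and> s \<le> a \<and> a + l \<le> e \<and> feasible n m p (move S (j, k, s, e) a l i t)))"

text \<open>\<open>xs ! r\<close> is the job written \<open>j\<close> with index \<open>r + 1\<close> in increasing order.\<close>

definition vertically_ordered :: "schedule \<Rightarrow> bool" where
  "vertically_ordered S \<longleftrightarrow>
     (\<forall>t. let xs = sorted_list_of_set (jobs_at S t) in
        \<forall>r < length xs. machine_of S (xs ! r) t = Suc r)"

definition pfs_like :: "nat \<Rightarrow> schedule \<Rightarrow> bool" where
  "pfs_like n S \<longleftrightarrow>
     vertically_ordered S \<and>
     (\<forall>j i. card {(s, e). (j, i, s, e) \<in> S} \<le> 1) \<and>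
     (\<exists>R. linear_order_on {1..n} R \<and>
        (\<forall>i j s e j' s' e'. (j, i, s, e) \<in> S \<and> (j', i, s', e') \<in> S \<and>
           (j, j') \<in> R \<and> j \<noteq> j' \<longrightarrow> e \<le> s'))"

text \<open>\<open>\<sigma> j\<close> is the new number of job \<open>j\<close>.\<close>

definition renumber :: "(nat \<Rightarrow> nat) \<Rightarrow> schedule \<Rightarrow> schedule" where
  "renumber \<sigma> S = (\<lambda>(j, i, s, e). (\<sigma> j, i, s, e)) ` S"

end

theory Submission
  imports "HOL-Analysis.Analysis" Defs
begin

text \<open>
  Number the jobs by their completion times \<open>d\<close> in an optimal schedule and let \<open>N\<^sub>j(t)\<close> be the number of
  jobs among the first \<open>j\<close> that are processed at time \<open>t\<close>. The quantities
  \<open>E\<^sub>j(h) = max (E\<^sub>j\<^sub>-\<^sub>1(h)) (E\<^sub>j\<^sub>-\<^sub>1(h - 1) + p\<^sub>j - d\<^sub>j)\<close> with \<open>E\<^sub>j(0) = p\<^sub>1 + \<dots> + p\<^sub>j\<close> bound the integral of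
  \<open>max 0 (N\<^sub>j(t) - h)\<close> from below, so \<open>E\<^sub>j(m) = 0\<close>. Letting machine \<open>i\<close> process job \<open>j\<close> from
  \<open>a\<^sub>i\<^sub>,\<^sub>j\<^sub>-\<^sub>1\<close> to \<open>a\<^sub>i\<^sub>,\<^sub>j\<close>, where \<open>a\<^sub>i\<^sub>,\<^sub>j = E\<^sub>j(i - 1) - E\<^sub>j(i)\<close>, gives a Permutation Flow Shop-like
  schedule in which job \<open>j\<close> is complete by time \<open>d\<^sub>j\<close>.

  The arrays \<open>a\<close> arising in this way, over all numberings of the jobs, form a compact set. One that
  minimises the sum of the \<open>a\<^sub>1\<^sub>,\<^sub>j\<close> yields a non-delay schedule: if part of a job could be moved
  earlier, moving the tail of its last piece instead would decrease its completion time, and the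
  construction applied to the resulting schedule would give a smaller sum.
\<close>

section \<open>Schedules from staircases\<close>

text \<open>\<open>a (i, j)\<close> is the time up to which machine \<open>i\<close> is busy once the first \<open>j\<close> jobs are scheduled.\<close>

definition staircase ::
  "nat \<Rightarrow> nat \<Rightarrow> (nat \<Rightarrow> real) \<Rightarrow> (nat \<times> nat \<Rightarrow> real) \<Rightarrow> bool" where
  "staircase n m q a \<longleftrightarrow>
     (\<forall>i \<in> {1..m}. a (i, 0) = 0) \<and>
     (\<forall>j < n. \<forall>i \<in> {1..m}. a (i, j) \<le> a (i, Suc j)) \<and>
     (\<forall>j < n. \<forall>i \<in> {1..<m}. a (Suc i, Suc j) \<le> a (i, j)) \<and>
     (\<forall>j < n. (\<Sum>i = 1..m. a (i, Suc j) - a (i, j)) = q (Suc j))"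

text \<open>\<open>\<pi> k\<close> is the job in position \<open>k\<close>, so
  \<open>inv \<pi>\<close> renumbers jobs by position. Empty intervals are dropped because the
  entries of a feasible schedule have positive length.\<close>

definition stair_schedule ::
  "nat \<Rightarrow> nat \<Rightarrow> (nat \<Rightarrow> nat) \<Rightarrow> (nat \<times> nat \<Rightarrow> real) \<Rightarrow> schedule" where
  "stair_schedule n m \<pi> a =
     {(\<pi> (Suc j), i, a (i, j), a (i, Suc j)) | j i. j < n \<and> i \<in> {1..m} \<and> a (i, j) < a (i, Suc j)}"

lemma staircase_mono:
  assumes "staircase n m q a" "i \<in> {1..m}" "j \<le> j'" "j' \<le> n"
  shows "a (i, j) \<le> a (i, j')"
  using assms(3,4)
proof (induction j' rule: dec_induct)
  case (step k)
  then show ?case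
    using assms(1,2) unfolding staircase_def by (meson Suc_le_lessD Suc_leD order_trans)
qed simp

lemma staircase_nonneg:
  assumes "staircase n m q a" "i \<in> {1..m}" "j \<le> n"
  shows "0 \<le> a (i, j)"
  using staircase_mono[OF assms(1,2), of 0 j] assms unfolding staircase_def by simp

text \<open>Chains the condition on adjacent machines with monotonicity in \<open>j\<close>. A job
  thus leaves a machine before it starts on any lower-numbered one.\<close>

lemma staircase_next_job:
  assumes st: "staircase n m q a" and "1 \<le> i" "i < i'" "i' \<le> m" "j < n"
  shows "a (i', Suc j) \<le> a (i, j)"
  using assms(3,4)
proof (induction i')
  case (Suc k)
  have step: "a (Suc k, Suc j) \<le> a (k, j)" if "1 \<le> k"
    using st that Suc.prems \<open>j < n\<close> unfolding staircase_def by auto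
  show ?case
  proof (cases "k = i")
    case True
    with step \<open>1 \<le> i\<close> show ?thesis by simp
  next
    case False
    then have "i < k" using Suc.prems by simp
    then have "a (k, Suc j) \<le> a (i, j)" using Suc by simp
    moreover have "a (k, j) \<le> a (k, Suc j)"
      using staircase_mono[OF st, of k j "Suc j"] \<open>i < k\<close> \<open>j < n\<close> Suc.prems by auto
    ultimately show ?thesis using step \<open>i < k\<close> by linarith
  qed
qed simp

lemma feasibleI:
  assumes "finite S"
    and "\<And>j i s e. (j, i, s, e) \<in> S \<Longrightarrow> j \<in> {1..n} \<and> i \<in> {1..m} \<and> 0 \<le> s \<and> s < e"
    and "\<And>j i s e j' i' s' e'. (j, i, s, e) \<in> S \<Longrightarrow> (j', i', s', e') \<in> S \<Longrightarrow>
      (j, i, s, e) \<noteq> (j', i', s', e') \<Longrightarrow> i = i' \<or> j = j' \<Longrightarrow> {s..<e} \<inter> {s'..<e'} = {}"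
    and "\<And>j. j \<in> {1..n} \<Longrightarrow> (\<Sum>(j', i, s, e) \<in> {q \<in> S. fst q = j}. e - s) = p j"
  shows "feasible n m p S"
  unfolding feasible_def using assms by (fastforce split: prod.splits)

text \<open>Pieces on one machine are separated by monotonicity in the position, pieces of one job
  by \<open>staircase_next_job\<close>; the last clause of \<open>staircase\<close> supplies the
  processing times.\<close>

lemma stair_schedule_feasible:
  assumes st: "staircase n m (\<lambda>j. p (\<pi> j)) a" and \<pi>: "\<pi> permutes {1..n}"
  shows "feasible n m p (stair_schedule n m \<pi> a)"
proof -
  let ?S = "stair_schedule n m \<pi> a"
  let ?g = "\<lambda>(j, i). (\<pi> (Suc j), i, a (i, j), a (i, Suc j))"
  have inj: "inj \<pi>" using \<pi> by (rule permutes_inj)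
  have "?S \<subseteq> ?g ` ({..<n} \<times> {1..m})"
    unfolding stair_schedule_def by auto
  then have fin: "finite ?S" by (rule finite_subset) auto
  have rng: "j \<in> {1..n} \<and> i \<in> {1..m} \<and> 0 \<le> s \<and> s < e" if "(j, i, s, e) \<in> ?S" for j i s e
  proof -
    from that obtain k where k: "k < n" "i \<in> {1..m}" "a (i, k) < a (i, Suc k)"
      "j = \<pi> (Suc k)" "s = a (i, k)" "e = a (i, Suc k)"
      unfolding stair_schedule_def by auto
    have "\<pi> (Suc k) \<in> {1..n}" using permutes_in_image[OF \<pi>, of "Suc k"] k by auto
    then show ?thesis using k staircase_nonneg[OF st, of i k] by auto
  qed
  have disj: "{s..<e} \<inter> {s'..<e'} = {}"
    if P: "(j, i, s, e) \<in> ?S" "(j', i', s', e') \<in> ?S"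
      and ne: "(j, i, s, e) \<noteq> (j', i', s', e')" and eq: "i = i' \<or> j = j'" for j i s e j' i' s' e'
  proof -
    from P(1) obtain k where k: "k < n" "i \<in> {1..m}"
      "j = \<pi> (Suc k)" "s = a (i, k)" "e = a (i, Suc k)"
      unfolding stair_schedule_def by auto
    from P(2) obtain k' where k': "k' < n" "i' \<in> {1..m}"
      "j' = \<pi> (Suc k')" "s' = a (i', k')" "e' = a (i', Suc k')"
      unfolding stair_schedule_def by auto
    have "e \<le> s' \<or> e' \<le> s"
    proof (cases "i = i'")
      case True
      then have "k \<noteq> k'" using ne k k' by auto
      then consider "Suc k \<le> k'" | "Suc k' \<le> k" by linarith
      then show ?thesis
        using staircase_mono[OF st, of i "Suc k" k'] staircase_mono[OF st, of i "Suc k'" k] True k k'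
        by cases auto
    next
      case False
      then have "k = k'" using eq k k' by (simp add: inj_eq[OF inj])
      from False consider "i < i'" | "i' < i" by linarith
      then show ?thesis
        using staircase_next_job[OF st, of i i' k] staircase_next_job[OF st, of i' i k] k k' \<open>k = k'\<close>
        by cases auto
    qed
    then show ?thesis by auto
  qed
  have sum: "(\<Sum>(j', i, s, e) \<in> {q \<in> ?S. fst q = j}. e - s) = p j" if "j \<in> {1..n}" for j
  proof -
    have "inv \<pi> j \<in> {1..n}" using that permutes_in_image[OF permutes_inv[OF \<pi>]] by simp
    then obtain k where k: "inv \<pi> j = Suc k" "k < n" by (cases "inv \<pi> j") auto
    then have jk: "j = \<pi> (Suc k)" using permutes_inverses(1)[OF \<pi>, of j] by simp
    let ?I = "{i \<in> {1..m}. a (i, k) < a (i, Suc k)}"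
    let ?h = "\<lambda>i. (j, i, a (i, k), a (i, Suc k))"
    have "{q \<in> ?S. fst q = j} = ?h ` ?I"
      unfolding stair_schedule_def jk using k(2) by (auto simp: inj_eq[OF inj])
    moreover have "inj_on ?h ?I" by (auto simp: inj_on_def)
    ultimately have "(\<Sum>(j', i, s, e) \<in> {q \<in> ?S. fst q = j}. e - s) = (\<Sum>i\<in>?I. a (i, Suc k) - a (i, k))"
      by (simp add: sum.reindex)
    also have "\<dots> = (\<Sum>i = 1..m. a (i, Suc k) - a (i, k))"
    proof (rule sum.mono_neutral_left)
      show "\<forall>i\<in>{1..m} - ?I. a (i, Suc k) - a (i, k) = 0"
        using staircase_mono[OF st, of _ k "Suc k"] k by (fastforce simp: not_less)
    qed auto
    also have "\<dots> = p j" using st k jk unfolding staircase_def by simp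
    finally show ?thesis .
  qed
  show ?thesis
    using fin rng disj sum by (rule feasibleI)
qed

lemma renumber_stair_schedule:
  assumes "\<pi> permutes {1..n}"
  shows "renumber (inv \<pi>) (stair_schedule n m \<pi> a) = stair_schedule n m id a"
proof -
  have "inv \<pi> (\<pi> j) = j" for j using assms by (simp add: permutes_inverses(2))
  then show ?thesis
    unfolding renumber_def stair_schedule_def by (fastforce simp: image_iff)
qed

text \<open>A job visits its machines in decreasing order, so the mark of machine 1 bounds all its
  ends, even if machine 1 gives it no piece.\<close>

lemma stair_schedule_end_le:
  assumes "staircase n m q a" "(j, i, s, e) \<in> stair_schedule n m \<pi> a" "inj \<pi>" "j = \<pi> (Suc k)"
  shows "e \<le> a (1, Suc k)"
proof -
  from assms have k: "k < n" "i \<in> {1..m}" "e = a (i, Suc k)"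
    unfolding stair_schedule_def by (auto simp: inj_eq)
  show ?thesis
  proof (cases "i = 1")
    case False
    then show ?thesis
      using staircase_next_job[OF assms(1), of 1 i k] staircase_mono[OF assms(1), of 1 k "Suc k"] k
      by force
  qed (use k in simp)
qed

text \<open>The machines busy at \<open>t\<close> form an initial segment (\<open>down\<close>) and
  the jobs increase strictly along it (\<open>order\<close>), so listing the jobs machine by machine
  is already their sorted enumeration.\<close>

lemma stair_schedule_vertically_ordered:
  assumes st: "staircase n m q a"
  shows "vertically_ordered (stair_schedule n m id a)"
  unfolding vertically_ordered_def Let_def
proof
  fix t
  let ?S = "stair_schedule n m id a"
  define active where
    "active i k \<longleftrightarrow> i \<in> {1..m} \<and> k < n \<and> a (i, k) \<le> t \<and> t < a (i, Suc k)" for i k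
  have proc: "processed_on ?S j i t \<longleftrightarrow> (\<exists>k. j = Suc k \<and> active i k)" for j i
    unfolding processed_on_def stair_schedule_def active_def by fastforce
  have order: "k < k'" if "active i k" "active i' k'" "i < i'" for i i' k k'
  proof (rule ccontr)
    assume "\<not> k < k'"
    then have "a (i', Suc k') \<le> a (i', Suc k)" "a (i', Suc k) \<le> a (i, k)"
      using staircase_mono[OF st, of i' "Suc k'" "Suc k"] staircase_next_job[OF st, of i i' k] that
      unfolding active_def by auto
    then show False using that unfolding active_def by linarith
  qed
  have unique: "k = k'" if "active i k" "active i k'" for i k k'
  proof -
    have "\<not> Suc k \<le> k'" "\<not> Suc k' \<le> k"
      using staircase_mono[OF st, of i "Suc k" k'] staircase_mono[OF st, of i "Suc k'" k] that
      unfolding active_def by auto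
    then show ?thesis by linarith
  qed
  have down: "\<exists>k. active i k" if "active i' k'" "1 \<le> i" "i \<le> i'" for i i' k'
  proof (cases "i = i'")
    case False
    then have i: "i < i'" "i' \<in> {1..m}" "i \<in> {1..m}" using that by (auto simp: active_def)
    have "t < a (i, k')"
      using staircase_next_job[OF st, of i i' k'] that i by (auto simp: active_def)
    \<comment> \<open>The first mark of machine \<open>i\<close> beyond \<open>t\<close> closes the
      interval containing \<open>t\<close>. It is not mark 0, as \<open>a (i, 0) = 0\<close> and
      \<open>t\<close> is non-negative.\<close>
    then have l: "t < a (i, LEAST l. t < a (i, l))" "(LEAST l. t < a (i, l)) \<le> k'"
      by (auto intro: LeastI Least_le)
    have "a (i, 0) \<le> t"
      using st i staircase_nonneg[OF st, of i' k'] that by (auto simp: active_def staircase_def)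
    then obtain k where k: "(LEAST l. t < a (i, l)) = Suc k"
      using l(1) by (cases "LEAST l. t < a (i, l)") auto
    then have "a (i, k) \<le> t" using not_less_Least[of k "\<lambda>l. t < a (i, l)"] by simp
    then have "active i k" using k l i that by (auto simp: active_def)
    then show ?thesis ..
  qed (use that in blast)
  obtain b where b: "{i. \<exists>k. active i k} = {1..b}"
  proof (cases "{i. \<exists>k. active i k} = {}")
    case True
    then show ?thesis using that[of 0] by simp
  next
    case False
    let ?B = "{i. \<exists>k. active i k}"
    have fin: "finite ?B" by (rule finite_subset[of _ "{1..m}"]) (auto simp: active_def)
    have "Max ?B \<in> ?B" using Max_in[OF fin False] .
    then obtain k where "active (Max ?B) k" by blast
    then have "?B = {1..Max ?B}"
      using down fin by (auto simp: active_def intro: Max_ge)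
    then show ?thesis using that by blast
  qed
  have "\<forall>i. \<exists>k. i \<in> {1..b} \<longrightarrow> active i k" using b by blast
  then obtain J where J: "\<And>i. i \<in> {1..b} \<Longrightarrow> active i (J i)" by metis
  let ?ys = "map (\<lambda>i. Suc (J i)) [1..<Suc b]"
  have "jobs_at ?S t = set ?ys"
  proof (rule set_eqI)
    fix j
    have "j \<in> jobs_at ?S t \<longleftrightarrow> (\<exists>i k. j = Suc k \<and> active i k)"
      by (auto simp: jobs_at_def proc)
    also have "\<dots> \<longleftrightarrow> (\<exists>i \<in> {1..b}. j = Suc (J i))"
      using b J unique by blast
    finally show "j \<in> jobs_at ?S t \<longleftrightarrow> j \<in> set ?ys" by auto
  qed
  moreover have "sorted_wrt (<) ?ys"
  proof -
    have "Suc (J (Suc x)) < Suc (J (Suc y))" if "x < y" "y < b" for x y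
      using order[OF J J, of "Suc x" "Suc y"] that by auto
    then show ?thesis by (auto simp: sorted_wrt_iff_nth_less simp del: upt_Suc)
  qed
  ultimately have xs: "sorted_list_of_set (jobs_at ?S t) = ?ys"
    by (metis List.finite_set set_sorted_list_of_set strict_sorted_equal strict_sorted_list_of_set)
  show "\<forall>r < length (sorted_list_of_set (jobs_at ?S t)).
    machine_of ?S (sorted_list_of_set (jobs_at ?S t) ! r) t = Suc r"
  proof (intro allI impI)
    fix r assume "r < length (sorted_list_of_set (jobs_at ?S t))"
    then have r: "Suc r \<in> {1..b}" and nth: "sorted_list_of_set (jobs_at ?S t) ! r = Suc (J (Suc r))"
      by (auto simp: xs simp del: upt_Suc)
    have "i = Suc r" if "active i (J (Suc r))" for i
      using order[OF that J[OF r]] order[OF J[OF r] that] by (meson less_irrefl linorder_neqE_nat)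
    then show "machine_of ?S (sorted_list_of_set (jobs_at ?S t) ! r) t = Suc r"
      unfolding machine_of_def nth proc using J[OF r] by (intro the_equality) auto
  qed
qed

lemma stair_schedule_pfs_like:
  assumes st: "staircase n m q a"
  shows "pfs_like n (stair_schedule n m id a)"
  unfolding pfs_like_def
proof (intro conjI allI exI)
  let ?S = "stair_schedule n m id a"
  show "vertically_ordered ?S" by (rule stair_schedule_vertically_ordered[OF st])
  show "card {(s, e). (j, i, s, e) \<in> ?S} \<le> 1" for j i
  proof -
    have "{(s, e). (j, i, s, e) \<in> ?S} \<subseteq> {(a (i, j - 1), a (i, j))}"
      by (auto simp: stair_schedule_def)
    from card_mono[OF _ this] show ?thesis by simp
  qed
  let ?R = "{(j, j'). j \<in> {1..n} \<and> j' \<in> {1..n} \<and> j \<le> j'}"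
  show "linear_order_on {1..n} ?R"
    unfolding linear_order_on_def partial_order_on_def preorder_on_def
    by (auto simp: refl_on_def trans_def antisym_def total_on_def)
  show "(j, i, s, e) \<in> ?S \<and> (j', i, s', e') \<in> ?S \<and> (j, j') \<in> ?R \<and> j \<noteq> j' \<longrightarrow> e \<le> s'"
    for i j s e j' s' e'
  proof
    assume P: "(j, i, s, e) \<in> ?S \<and> (j', i, s', e') \<in> ?S \<and> (j, j') \<in> ?R \<and> j \<noteq> j'"
    then obtain k k' where k: "j = Suc k" "j' = Suc k'" "k' < n" "i \<in> {1..m}"
      "e = a (i, Suc k)" "s' = a (i, k')"
      unfolding stair_schedule_def by auto
    with P have "Suc k \<le> k'" by simp
    then show "e \<le> s'" using staircase_mono[OF st k(4)] k by simp
  qed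
qed

section \<open>Staircases from schedules\<close>

text \<open>This is Sahni's algorithm in closed form: \<open>excess q d j h\<close> is the total busy time of the
  machines \<open>i > h\<close> when the jobs \<open>1, \<dots>, j\<close> with due dates \<open>d\<close> are packed as late as the staircase
  shape permits.\<close>

fun excess :: "(nat \<Rightarrow> real) \<Rightarrow> (nat \<Rightarrow> real) \<Rightarrow> nat \<Rightarrow> nat \<Rightarrow> real" where
  "excess q d 0 h = 0"
| "excess q d (Suc j) 0 = excess q d j 0 + q (Suc j)"
| "excess q d (Suc j) (Suc h) = max (excess q d j (Suc h)) (excess q d j h + q (Suc j) - d (Suc j))"

text \<open>The busy time of machine \<open>h + 1\<close> as a difference of tail sums; machines
  count from 1 but \<open>h\<close> from 0.\<close>

definition level :: "(nat \<Rightarrow> real) \<Rightarrow> (nat \<Rightarrow> real) \<Rightarrow> nat \<Rightarrow> nat \<Rightarrow> real" where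
  "level q d j h = excess q d j h - excess q d j (Suc h)"

text \<open>Let \<open>L = level q d j\<close> and
  \<open>\<phi> y = max 0 (y + q (Suc j) - d (Suc j))\<close>, which is non-decreasing and
  1-Lipschitz. The new level is \<open>L (Suc h) + \<phi> (L h) - \<phi> (L (Suc h))\<close> at
  \<open>Suc h\<close>, and \<open>min (L 0 + q (Suc j)) (d (Suc j))\<close> at 0.\<close>

lemma level_Suc:
  assumes anti: "\<And>h. level q d j (Suc h) \<le> level q d j h"
    and "level q d j 0 \<le> d (Suc j)" "0 \<le> q (Suc j)"
  shows "level q d j h \<le> level q d (Suc j) h"
    and "level q d (Suc j) (Suc h) \<le> level q d j h"
    and "level q d (Suc j) 0 \<le> d (Suc j)"
proof -
  show "level q d j h \<le> level q d (Suc j) h"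
  proof (cases h)
    case 0
    then show ?thesis using assms(2,3) by (simp add: level_def)
  next
    case (Suc k)
    then show ?thesis using anti[of k] by (simp add: level_def)
  qed
  show "level q d (Suc j) (Suc h) \<le> level q d j h"
    using anti[of h] by (simp add: level_def max_def)
  show "level q d (Suc j) 0 \<le> d (Suc j)"
    by (simp add: level_def max_def)
qed

text \<open>The two claims share one induction because \<open>level_Suc\<close> uses both.
  Sortedness carries the bound by \<open>d (Suc j)\<close> over to all later due dates.\<close>

lemma level_invariant:
  assumes "\<And>j. j \<in> {1..n} \<Longrightarrow> 0 \<le> q j" "\<And>j. j \<in> {1..n} \<Longrightarrow> 0 \<le> d j"
    and "\<And>i j. 1 \<le> i \<Longrightarrow> i \<le> j \<Longrightarrow> j \<le> n \<Longrightarrow> d i \<le> d j"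
    and "j \<le> n"
  shows "(\<forall>h. level q d j (Suc h) \<le> level q d j h) \<and> (\<forall>k. j < k \<and> k \<le> n \<longrightarrow> level q d j 0 \<le> d k)"
  using \<open>j \<le> n\<close>
proof (induction j)
  case 0
  then show ?case using assms(2) by (simp add: level_def)
next
  case (Suc j)
  then have "level q d j 0 \<le> d (Suc j)" "0 \<le> q (Suc j)" "\<And>h. level q d j (Suc h) \<le> level q d j h"
    using assms(1) by auto
  note * = level_Suc[OF this(3,1,2)]
  have "level q d (Suc j) (Suc h) \<le> level q d (Suc j) h" for h
    using *(1,2)[of h] by linarith
  moreover have "level q d (Suc j) 0 \<le> d k" if "Suc j < k" "k \<le> n" for k
    using *(3) assms(3)[of "Suc j" k] that by simp
  ultimately show ?case by blast
qed

lemma excess_nonneg: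
  assumes "\<And>j. j \<in> {1..n} \<Longrightarrow> 0 \<le> q j" "j \<le> n"
  shows "0 \<le> excess q d j h"
  using \<open>j \<le> n\<close>
proof (induction j arbitrary: h)
  case (Suc j)
  have "0 \<le> q (Suc j)" using assms(1) Suc.prems by simp
  then show ?case using Suc.IH[of h] Suc.IH[of 0] Suc.prems by (cases h) (auto simp: le_max_iff_disj)
qed simp

text \<open>Each argument of the \<open>max\<close> in \<open>excess\<close> is bounded through an
  inequality between integrands. At \<open>h = m\<close> the integrand vanishes if at most
  \<open>m\<close> jobs run at any time; this is how machine capacity enters.\<close>

lemma excess_le_integral:
  fixes x :: "nat \<Rightarrow> real \<Rightarrow> real"
  assumes x: "\<And>j t. j \<in> {1..n} \<Longrightarrow> x j t \<in> {0, 1}"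
    and x0: "\<And>j t. j \<in> {1..n} \<Longrightarrow> t \<notin> {0..<d j} \<Longrightarrow> x j t = 0"
    and int: "\<And>j. j \<in> {1..n} \<Longrightarrow> integrable lborel (x j)"
    and q: "\<And>j. j \<in> {1..n} \<Longrightarrow> integral\<^sup>L lborel (x j) = q j"
    and d0: "\<And>j. j \<in> {1..n} \<Longrightarrow> 0 \<le> d j"
    and sorted: "\<And>i j. 1 \<le> i \<Longrightarrow> i \<le> j \<Longrightarrow> j \<le> n \<Longrightarrow> d i \<le> d j"
    and "j \<le> n"
  shows "excess q d j h \<le> (\<integral>t. max 0 ((\<Sum>k = 1..j. x k t) - real h) \<partial>lborel)"
  using \<open>j \<le> n\<close>
proof (induction j arbitrary: h)
  case (Suc j)
  define N where "N \<equiv> \<lambda>t. \<Sum>k = 1..j. x k t"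
  have N_Suc: "(\<Sum>k = 1..Suc j. x k t) = N t + x (Suc j) t" for t
    by (simp add: N_def)
  have xnn: "0 \<le> x k t" if "k \<in> {1..n}" for k t
    using x[OF that, of t] by auto
  have Nnn: "0 \<le> N t" for t
    unfolding N_def using Suc.prems by (intro sum_nonneg xnn) auto
  have intN: "integrable lborel N"
    unfolding N_def using Suc.prems by (intro Bochner_Integration.integrable_sum int) auto
  have intx: "integrable lborel (x (Suc j))" "integral\<^sup>L lborel (x (Suc j)) = q (Suc j)"
    using int q Suc.prems by auto
  have cut: "integrable lborel (\<lambda>t. max 0 (g t - real h))"
    if "integrable lborel g" "\<And>t. 0 \<le> g t" for g :: "real \<Rightarrow> real" and h :: nat
  proof (rule Bochner_Integration.integrable_bound[OF that(1)])
    show "(\<lambda>t. max 0 (g t - real h)) \<in> borel_measurable lborel"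
      using borel_measurable_integrable[OF that(1)] by measurable
    show "AE t in lborel. norm (max 0 (g t - real h)) \<le> norm (g t)"
      using that(2) by auto
  qed
  have IH: "excess q d j h \<le> (\<integral>t. max 0 (N t - real h) \<partial>lborel)" for h
    using Suc unfolding N_def by simp
  have intN': "integrable lborel (\<lambda>t. N t + x (Suc j) t)" "\<And>t. 0 \<le> N t + x (Suc j) t"
    using intN intx Nnn xnn Suc.prems by auto
  show ?case
  proof (cases h)
    case 0
    have "excess q d (Suc j) h \<le> integral\<^sup>L lborel N + integral\<^sup>L lborel (x (Suc j))"
      using IH[of 0] Nnn intx 0 by simp
    also have "\<dots> = (\<integral>t. N t + x (Suc j) t \<partial>lborel)"
      using intN intx by simp
    finally show ?thesis
      unfolding N_Suc using 0 intN'(2) by simp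
  next
    case (Suc h')
    have "excess q d j h \<le> (\<integral>t. max 0 (N t + x (Suc j) t - real h) \<partial>lborel)"
    proof (rule order_trans[OF IH], rule integral_mono)
      show "max 0 (N t - real h) \<le> max 0 (N t + x (Suc j) t - real h)" for t
        using xnn[of "Suc j" t] Suc.prems by auto
    qed (use cut intN Nnn intN' in auto)
    moreover have "excess q d j h' + q (Suc j) - d (Suc j) \<le> (\<integral>t. max 0 (N t + x (Suc j) t - real h) \<partial>lborel)"
    proof -
      \<comment> \<open>Writing the due date as the integral of this indicator turns the bound into
        a pointwise comparison.\<close>
      let ?I = "indicator {0..<d (Suc j)} :: real \<Rightarrow> real"
      have dS: "0 \<le> d (Suc j)" using d0 Suc.prems by simp
      have intI: "integrable lborel ?I" "integral\<^sup>L lborel ?I = d (Suc j)"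
        using dS by auto
      have "excess q d j h' + q (Suc j) - d (Suc j) \<le>
        (\<integral>t. max 0 (N t - real h') \<partial>lborel) + integral\<^sup>L lborel (x (Suc j)) - integral\<^sup>L lborel ?I"
        using IH[of h'] intI intx by simp
      also have "\<dots> = (\<integral>t. max 0 (N t - real h') + x (Suc j) t - ?I t \<partial>lborel)"
        using cut[OF intN Nnn, of h'] intI intx by simp
      also have "\<dots> \<le> (\<integral>t. max 0 (N t + x (Suc j) t - real h) \<partial>lborel)"
      proof (rule integral_mono)
        \<comment> \<open>Where job \<open>Suc j\<close> is not processed, the cut-off integrand drops by at most \<open>1\<close>; since
          due dates are sorted, everything vanishes from \<open>d (Suc j)\<close> on.\<close>
        show "max 0 (N t - real h') + x (Suc j) t - ?I t \<le> max 0 (N t + x (Suc j) t - real h)" for t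
        proof (cases "t \<in> {0..<d (Suc j)}")
          case True
          then show ?thesis using x[of "Suc j" t] Suc.prems \<open>h = Suc h'\<close> by auto
        next
          case False
          have "x k t = 0" if "k \<in> {1..Suc j}" for k
            using x0[of k t] sorted[of k "Suc j"] that Suc.prems False by auto
          then have "N t = 0" "x (Suc j) t = 0" by (auto simp: N_def)
          then show ?thesis by (auto simp: indicator_def)
        qed
      qed (use cut intN Nnn intN' intI intx in auto)
      finally show ?thesis .
    qed
    ultimately show ?thesis unfolding N_Suc using Suc by simp
  qed
qed simp

text \<open>Capacity forces \<open>excess q d j m = 0\<close>, so the levels of the \<open>m\<close>
  machines telescope to \<open>excess q d j 0\<close>, which grows by exactly
  \<open>q (Suc j)\<close>. The array is 0 off the grid so that it is bounded on all pairs.\<close>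

lemma staircase_exists:
  fixes x :: "nat \<Rightarrow> real \<Rightarrow> real"
  assumes x: "\<And>j t. j \<in> {1..n} \<Longrightarrow> x j t \<in> {0, 1}"
    and x0: "\<And>j t. j \<in> {1..n} \<Longrightarrow> t \<notin> {0..<d j} \<Longrightarrow> x j t = 0"
    and int: "\<And>j. j \<in> {1..n} \<Longrightarrow> integrable lborel (x j)"
    and q: "\<And>j. j \<in> {1..n} \<Longrightarrow> integral\<^sup>L lborel (x j) = q j"
    and d0: "\<And>j. j \<in> {1..n} \<Longrightarrow> 0 \<le> d j"
    and sorted: "\<And>i j. 1 \<le> i \<Longrightarrow> i \<le> j \<Longrightarrow> j \<le> n \<Longrightarrow> d i \<le> d j"
    and cap: "\<And>t. (\<Sum>k = 1..n. x k t) \<le> real m"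
  obtains a where "staircase n m q a" "\<And>j. j < n \<Longrightarrow> a (1, Suc j) \<le> d (Suc j)"
    "\<And>i j. i \<notin> {1..m} \<or> n < j \<Longrightarrow> a (i, j) = 0"
proof
  let ?a = "\<lambda>(i, j). if i \<in> {1..m} \<and> j \<le> n then level q d j (i - 1) else 0"
  have q0: "0 \<le> q j" if "j \<in> {1..n}" for j
  proof -
    have "0 \<le> x j t" for t using x[OF that, of t] by auto
    then show ?thesis unfolding q[OF that, symmetric] by (simp add: integral_nonneg_AE)
  qed
  have Em: "excess q d j m = 0" if "j \<le> n" for j
  proof -
    have "(\<Sum>k = 1..j. x k t) \<le> real m" for t
    proof (rule order_trans[OF sum_mono2 cap])
      show "0 \<le> x b t" if "b \<in> {1..n} - {1..j}" for b
        using x[of b t] that by auto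
    qed (use that in auto)
    then have "max 0 ((\<Sum>k = 1..j. x k t) - real m) = 0" for t
      by (simp add: max.absorb1)
    then have "excess q d j m \<le> 0"
      using excess_le_integral[where x = x and q = q and d = d and j = j and h = m and n = n,
          OF x x0 int q d0 sorted that] by simp
    then show ?thesis using excess_nonneg[of n q j d m] q0 that by simp
  qed
  note inv = level_invariant[of n q d, OF q0 d0 sorted]
  have step: "level q d j h \<le> level q d (Suc j) h" "level q d (Suc j) (Suc h) \<le> level q d j h"
     "level q d (Suc j) 0 \<le> d (Suc j)" if "j < n" for j h
    using level_Suc[of q d j] inv[of j] q0[of "Suc j"] that by auto
  have sum: "(\<Sum>i = 1..m. level q d j (i - 1)) = excess q d j 0" if "j \<le> n" for j
  proof -
    have "(\<Sum>i = 1..m. level q d j (i - 1)) = (\<Sum>i<m. level q d j i)"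
      by (rule sum.reindex_bij_witness[of _ Suc "\<lambda>i. i - 1"]) auto
    also have "\<dots> = excess q d j 0 - excess q d j m"
      unfolding level_def by (rule sum_lessThan_telescope')
    finally show ?thesis using Em that by simp
  qed
  show "staircase n m q ?a"
    unfolding staircase_def
  proof (intro conjI allI ballI impI)
    fix i
    show "?a (i, 0) = 0" by (simp add: level_def)
  next
    fix j i assume "j < n" "i \<in> {1..<m}"
    then show "?a (Suc i, Suc j) \<le> ?a (i, j)"
      using step(2)[of j "i - 1"] by auto
  next
    fix j assume "j < n"
    then have "(\<Sum>i = 1..m. ?a (i, Suc j) - ?a (i, j)) =
      (\<Sum>i = 1..m. level q d (Suc j) (i - 1) - level q d j (i - 1))"
      by (intro sum.cong) auto
    also have "\<dots> = q (Suc j)"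
      using sum[of j] sum[of "Suc j"] \<open>j < n\<close> by (simp add: sum_subtractf)
    finally show "(\<Sum>i = 1..m. ?a (i, Suc j) - ?a (i, j)) = q (Suc j)" .
  qed (use step(1) in auto)
  show "?a (1, Suc j) \<le> d (Suc j)" if "j < n" for j
    using step(3) that d0[of "Suc j"] by auto
  show "?a (i, j) = 0" if "i \<notin> {1..m} \<or> n < j" for i j
    using that by auto
qed

section \<open>Feasible schedules as 0/1 processing functions\<close>

lemma feasibleD:
  assumes "feasible n m p S"
  shows "finite S"
    and "(j, i, s, e) \<in> S \<Longrightarrow> j \<in> {1..n} \<and> i \<in> {1..m} \<and> 0 \<le> s \<and> s < e"
    and "(j, i, s, e) \<in> S \<Longrightarrow> (j', i', s', e') \<in> S \<Longrightarrow> (j, i, s, e) \<noteq> (j', i', s', e') \<Longrightarrow>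
      i = i' \<or> j = j' \<Longrightarrow> {s..<e} \<inter> {s'..<e'} = {}"
    and "j \<in> {1..n} \<Longrightarrow> (\<Sum>(j', i, s, e) \<in> {q \<in> S. fst q = j}. e - s) = p j"
  using assms unfolding feasible_def by fast+

fun time_span :: "piece \<Rightarrow> real set" where
  "time_span (j, i, s, e) = {s..<e}"

lemma feasible_span_disjoint:
  assumes "feasible n m p S" "q \<in> S" "q' \<in> S" "q \<noteq> q'" "fst (snd q) = fst (snd q') \<or> fst q = fst q'"
  shows "time_span q \<inter> time_span q' = {}"
proof -
  obtain j i s e j' i' s' e' where q: "q = (j, i, s, e)" "q' = (j', i', s', e')"
    by (cases q, cases q')
  show ?thesis
    using feasibleD(3)[OF assms(1), of j i s e j' i' s' e'] assms(2-5) unfolding q by simp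
qed

lemma sum_indicator_disjoint:
  assumes "finite A" "\<And>x y. x \<in> A \<Longrightarrow> y \<in> A \<Longrightarrow> x \<noteq> y \<Longrightarrow> F x \<inter> F y = {}"
  shows "(\<Sum>x\<in>A. indicator (F x) t :: real) \<in> {0, 1}"
proof (cases "\<exists>x\<in>A. t \<in> F x")
  case True
  then obtain x where x: "x \<in> A" "t \<in> F x" by blast
  have "t \<notin> F y" if "y \<in> A - {x}" for y
    using assms(2)[of x y] x that by blast
  then have "(\<Sum>y\<in>A - {x}. indicator (F y) t :: real) = 0"
    by (intro sum.neutral) (simp add: indicator_def)
  then show ?thesis using x assms(1) by (simp add: sum.remove)
qed simp

text \<open>The function \<open>x j\<close> indicates when job \<open>j\<close> is processed, so its
  integral is \<open>p j\<close>. The due dates \<open>d\<close> are arbitrary bounds on the ends of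
  pieces, sorted by \<open>\<pi>\<close>.\<close>

lemma feasible_imp_staircase:
  assumes feas: "feasible n m p S" and \<pi>: "\<pi> permutes {1..n}"
    and ends: "\<And>j i s e. (j, i, s, e) \<in> S \<Longrightarrow> e \<le> d j"
    and d0: "\<And>j. j \<in> {1..n} \<Longrightarrow> 0 \<le> d j"
    and sorted: "\<And>i j. 1 \<le> i \<Longrightarrow> i \<le> j \<Longrightarrow> j \<le> n \<Longrightarrow> d (\<pi> i) \<le> d (\<pi> j)"
  obtains a where "staircase n m (\<lambda>j. p (\<pi> j)) a" "\<And>j. j < n \<Longrightarrow> a (1, Suc j) \<le> d (\<pi> (Suc j))"
    "\<And>i j. i \<notin> {1..m} \<or> n < j \<Longrightarrow> a (i, j) = 0"
proof -
  note F = feasibleD[OF feas]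
  define x where "x j t = (\<Sum>q \<in> {q \<in> S. fst q = j}. indicator (time_span q) t :: real)" for j t
  have img: "\<pi> j \<in> {1..n}" if "j \<in> {1..n}" for j
    using permutes_in_image[OF \<pi>] that by simp
  have fin: "finite {q \<in> S. fst q = j}" for j using F(1) by simp
  have ind: "integrable lborel (indicator (time_span q) :: real \<Rightarrow> real)" for q
  proof (cases q)
    case (fields j i s e)
    then show ?thesis by (cases "s \<le> e") auto
  qed
  have lint: "integral\<^sup>L lborel (indicator (time_span q) :: real \<Rightarrow> real) = (case q of (j, i, s, e) \<Rightarrow> e - s)"
    if "q \<in> S" for q
  proof (cases q)
    case (fields j i s e)
    then show ?thesis using F(2)[of j i s e] that by simp
  qed
  show ?thesis
  proof (rule staircase_exists[of n "\<lambda>j. x (\<pi> j)" "\<lambda>j. d (\<pi> j)" "\<lambda>j. p (\<pi> j)" m])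
    fix j assume j: "j \<in> {1..n}"
    show "x (\<pi> j) t \<in> {0, 1}" for t
      unfolding x_def by (rule sum_indicator_disjoint[OF fin]) (simp add: feasible_span_disjoint[OF feas])
    show "x (\<pi> j) t = 0" if "t \<notin> {0..<d (\<pi> j)}" for t
      unfolding x_def
    proof (intro sum.neutral ballI)
      fix q assume q: "q \<in> {q \<in> S. fst q = \<pi> j}"
      show "indicator (time_span q) t = (0::real)"
      proof (cases q)
        case (fields j i s e)
        then show ?thesis
          using q ends[of j i s e] F(2)[of j i s e] that by (auto simp: indicator_def)
      qed
    qed
    show "integrable lborel (x (\<pi> j))"
      unfolding x_def[abs_def] by (intro Bochner_Integration.integrable_sum ind)
    have "integral\<^sup>L lborel (x (\<pi> j)) = (\<Sum>q \<in> {q \<in> S. fst q = \<pi> j}. integral\<^sup>L lborel (indicator (time_span q)))"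
      unfolding x_def[abs_def] by (intro Bochner_Integration.integral_sum ind)
    also have "\<dots> = (\<Sum>(j', i, s, e) \<in> {q \<in> S. fst q = \<pi> j}. e - s)"
      by (intro sum.cong refl lint) simp
    also have "\<dots> = p (\<pi> j)" using F(4) img[OF j] by simp
    finally show "integral\<^sup>L lborel (x (\<pi> j)) = p (\<pi> j)" .
    show "0 \<le> d (\<pi> j)" using d0 img[OF j] .
  next
    fix t
    let ?A = "{q \<in> S. t \<in> time_span q}"
    have "(\<Sum>k = 1..n. x (\<pi> k) t) = (\<Sum>k = 1..n. x k t)"
      using sum.permute[OF \<pi>, of "\<lambda>k. x k t"] by (simp add: comp_def)
    also have "\<dots> = (\<Sum>q\<in>S. indicator (time_span q) t)"
      unfolding x_def using F(1,2) by (intro sum.group) auto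
    also have "\<dots> = real (card ?A)"
    proof -
      have "(\<Sum>q\<in>S. indicator (time_span q) t :: real) = (\<Sum>q\<in>S. if t \<in> time_span q then 1 else 0)"
        by (intro sum.cong) (auto simp: indicator_def)
      then show ?thesis using F(1) by (simp add: sum.If_cases Int_def)
    qed
    also have "\<dots> \<le> real m"
    proof -
      \<comment> \<open>Pieces running at the same time sit on different machines, so there are at
        most \<open>m\<close> of them.\<close>
      have "inj_on (fst \<circ> snd) ?A"
      proof (rule inj_onI, rule ccontr)
        fix q q' assume "q \<in> ?A" "q' \<in> ?A" "(fst \<circ> snd) q = (fst \<circ> snd) q'" "q \<noteq> q'"
        then show False using feasible_span_disjoint[OF feas, of q q'] by auto
      qed
      moreover have "(fst \<circ> snd) ` ?A \<subseteq> {1..m}"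
        using F(2) by fastforce
      ultimately have "card ?A \<le> card {1..m}"
        by (rule card_inj_on_le) simp
      then show ?thesis by simp
    qed
    finally show "(\<Sum>k = 1..n. x (\<pi> k) t) \<le> real m" .
  qed (use sorted that in auto)
qed

section \<open>Completion times, sorting, and shifting the end of a piece\<close>

lemma completion_ge:
  assumes "feasible n m p S" "(j, i, s, e) \<in> S"
  shows "e \<le> completion S j"
proof -
  have "{e. \<exists>i s. (j, i, s, e) \<in> S} \<subseteq> (\<lambda>(j, i, s, e). e) ` S" by force
  then have "finite {e. \<exists>i s. (j, i, s, e) \<in> S}"
    using feasibleD(1)[OF assms(1)] by (meson finite_imageI finite_subset)
  then show ?thesis unfolding completion_def using assms(2) by (intro Max_ge) auto
qed

text \<open>Since \<open>0 < p j\<close>, the job has a piece, so the \<open>Max\<close> in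
  \<open>completion\<close> ranges over a non-empty finite set.\<close>

lemma completion_attained:
  assumes feas: "feasible n m p S" and j: "j \<in> {1..n}" "0 < p j"
  obtains i s where "(j, i, s, completion S j) \<in> S"
proof -
  let ?E = "{e. \<exists>i s. (j, i, s, e) \<in> S}"
  have "{q \<in> S. fst q = j} \<noteq> {}"
    using feasibleD(4)[OF feas j(1)] j(2) by (metis less_irrefl sum.empty)
  then have "?E \<noteq> {}" by force
  moreover have "?E \<subseteq> (\<lambda>(j, i, s, e). e) ` S" by force
  then have "finite ?E"
    using feasibleD(1)[OF feas] by (meson finite_imageI finite_subset)
  ultimately have "Max ?E \<in> ?E" by (rule Max_in[rotated])
  then show ?thesis using that unfolding completion_def by blast
qed

lemma completion_nonneg:
  assumes "feasible n m p S" "j \<in> {1..n}" "0 < p j"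
  shows "0 \<le> completion S j"
  using completion_attained[OF assms] feasibleD(2)[OF assms(1)] by (metis less_imp_le order_trans)

lemma sorting_permutation:
  fixes d :: "nat \<Rightarrow> real"
  obtains \<pi> where "\<pi> permutes {1..n}" "\<And>i j. 1 \<le> i \<Longrightarrow> i \<le> j \<Longrightarrow> j \<le> n \<Longrightarrow> d (\<pi> i) \<le> d (\<pi> j)"
proof
  let ?xs = "sort_key d [1..<Suc n]"
  \<comment> \<open>List positions start at 0 and jobs at 1; outside \<open>{1..n}\<close>,
    \<open>permutes\<close> demands the identity.\<close>
  let ?\<pi> = "\<lambda>j. if j \<in> {1..n} then ?xs ! (j - 1) else j"
  have "bij_betw (\<lambda>j. ?xs ! (j - 1)) {1..n} {1..n}"
  proof -
    have "bij_betw ((!) ?xs) {..<n} {1..n}"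
      by (rule bij_betw_nth) (auto simp del: upt_Suc)
    moreover have "bij_betw (\<lambda>j. j - 1) {1..n} {..<n}"
      by (rule bij_betw_byWitness[where f' = Suc]) auto
    ultimately show ?thesis
      using bij_betw_trans by (fastforce simp: comp_def)
  qed
  then have "bij_betw ?\<pi> {1..n} {1..n}"
    by (subst bij_betw_cong[where g = "\<lambda>j. ?xs ! (j - 1)"]) auto
  then show "?\<pi> permutes {1..n}"
    by (rule bij_imp_permutes) (simp del: atLeastAtMost_iff)
  show "d (?\<pi> i) \<le> d (?\<pi> j)" if "1 \<le> i" "i \<le> j" "j \<le> n" for i j
    using sorted_nth_mono[OF sorted_sort_key[of d "[1..<Suc n]"], of "i - 1" "j - 1"] that
    by (simp del: upt_Suc)
qed

text \<open>Shortening a piece cannot create overlaps, so only the new entry has to be checked, and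
  its slot is free for both the job and the machine.\<close>

lemma feasible_shift_tail:
  assumes feas: "feasible n m p S" and P: "(j, k, s, e) \<in> S"
    and \<delta>: "0 < \<delta>" "\<delta> < e - s" and i: "i \<in> {1..m}" and t: "0 \<le> t"
    and job: "\<And>k' s' e'. (j, k', s', e') \<in> S \<Longrightarrow> {s'..<e'} \<inter> {t..<t + \<delta>} = {}"
    and mach: "\<And>j' s' e'. (j', i, s', e') \<in> S \<Longrightarrow> {s'..<e'} \<inter> {t..<t + \<delta>} = {}"
  shows "feasible n m p (insert (j, i, t, t + \<delta>) (insert (j, k, s, e - \<delta>) (S - {(j, k, s, e)})))"
    (is "feasible n m p ?S'")
proof -
  note F = feasibleD[OF feas]
  let ?N = "(j, i, t, t + \<delta>)" and ?T = "(j, k, s, e - \<delta>)" and ?P = "(j, k, s, e)"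
  let ?len = "\<lambda>(j' :: nat, i :: nat, s :: real, e). e - s"
  \<comment> \<open>Schedules are sets: if an inserted entry coincided with another one, its length
    would be lost from the sum.\<close>
  have NS: "?N \<notin> S" using job[of i t "t + \<delta>"] \<delta> by auto
  have TS: "?T \<notin> S - {?P}"
  proof
    assume "?T \<in> S - {?P}"
    then have "{s..<e - \<delta>} \<inter> {s..<e} = {}" using F(3)[OF _ P, of j k s "e - \<delta>"] by auto
    then show False using \<delta> by (auto simp: Int_def ivl_disj_int)
  qed
  have NT: "?N \<noteq> ?T" using job[OF P] \<delta> by (auto simp: disjoint_iff)
  have rng: "j' \<in> {1..n} \<and> i' \<in> {1..m} \<and> 0 \<le> s' \<and> s' < e'" if "(j', i', s', e') \<in> ?S'" for j' i' s' e'
    using that F(2)[OF P] F(2)[of j' i' s' e'] \<delta> i t by auto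
  \<comment> \<open>Every retained entry extends to an entry of \<open>S\<close> with the same
    start. The last disjunct ensures that distinct entries have distinct extensions, so disjointness
    is inherited from \<open>S\<close>.\<close>
  have cover: "\<exists>u. e' \<le> u \<and> (j', i', s', u) \<in> S \<and> ((j', i', s', e') = ?T \<and> u = e \<or> u = e' \<and> (j', i', s', u) \<noteq> ?P)"
    if "(j', i', s', e') \<in> insert ?T (S - {?P})" for j' i' s' e'
  proof (cases "(j', i', s', e') = ?T")
    case True
    then show ?thesis using P \<delta> by (intro exI[of _ e]) auto
  next
    case False
    then show ?thesis using that by (intro exI[of _ e']) auto
  qed
  have new: "{s'..<e'} \<inter> {t..<t + \<delta>} = {}"
    if "(j', i', s', e') \<in> insert ?T (S - {?P})" "i' = i \<or> j' = j" for j' i' s' e'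
  proof -
    from cover[OF that(1)] obtain u where u: "e' \<le> u" "(j', i', s', u) \<in> S" by blast
    then have "{s'..<u} \<inter> {t..<t + \<delta>} = {}"
      using that(2) mach job by blast
    moreover have "{s'..<e'} \<subseteq> {s'..<u}" using u by auto
    ultimately show ?thesis by blast
  qed
  have old: "{s'..<e'} \<inter> {s''..<e''} = {}"
    if q: "(j', i', s', e') \<in> insert ?T (S - {?P})" "(j'', i'', s'', e'') \<in> insert ?T (S - {?P})"
      "(j', i', s', e') \<noteq> (j'', i'', s'', e'')" "i' = i'' \<or> j' = j''" for j' i' s' e' j'' i'' s'' e''
  proof -
    from cover[OF q(1)] obtain u where u: "e' \<le> u" "(j', i', s', u) \<in> S"
      "(j', i', s', e') = ?T \<and> u = e \<or> u = e' \<and> (j', i', s', u) \<noteq> ?P" by blast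
    from cover[OF q(2)] obtain v where v: "e'' \<le> v" "(j'', i'', s'', v) \<in> S"
      "(j'', i'', s'', e'') = ?T \<and> v = e \<or> v = e'' \<and> (j'', i'', s'', v) \<noteq> ?P" by blast
    have "(j', i', s', u) \<noteq> (j'', i'', s'', v)" using u(3) v(3) q(3) by auto
    then have "{s'..<u} \<inter> {s''..<v} = {}" using F(3)[OF u(2) v(2)] q(4) by blast
    moreover have "{s'..<e'} \<subseteq> {s'..<u}" "{s''..<e''} \<subseteq> {s''..<v}" using u v by auto
    ultimately show ?thesis by blast
  qed
  have disj: "{s'..<e'} \<inter> {s''..<e''} = {}"
    if q: "(j', i', s', e') \<in> ?S'" "(j'', i'', s'', e'') \<in> ?S'"
      "(j', i', s', e') \<noteq> (j'', i'', s'', e'')" "i' = i'' \<or> j' = j''" for j' i' s' e' j'' i'' s'' e''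
  proof (cases "(j', i', s', e') = ?N")
    case True
    then have "(j'', i'', s'', e'') \<in> insert ?T (S - {?P})" using q by auto
    from new[OF this] show ?thesis using True q(4) by auto
  next
    case False
    then have *: "(j', i', s', e') \<in> insert ?T (S - {?P})" using q by auto
    show ?thesis
    proof (cases "(j'', i'', s'', e'') = ?N")
      case True
      then show ?thesis using new[OF *] q(4) by auto
    next
      case False
      then show ?thesis using old[OF * _ q(3,4)] q(2) by blast
    qed
  qed
  have sum: "(\<Sum>q \<in> {q \<in> ?S'. fst q = j'}. ?len q) = p j'" if "j' \<in> {1..n}" for j'
  proof (cases "j' = j")
    case False
    then have "{q \<in> ?S'. fst q = j'} = {q \<in> S. fst q = j'}" by auto
    then show ?thesis using F(4) that by simp
  next
    case True
    let ?R = "{q \<in> S. fst q = j} - {?P}"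
    have fin: "finite ?R" using F(1) by simp
    have "{q \<in> ?S'. fst q = j'} = insert ?N (insert ?T ?R)" using True by auto
    then have "(\<Sum>q \<in> {q \<in> ?S'. fst q = j'}. ?len q) = \<delta> + (e - \<delta> - s + (\<Sum>q\<in>?R. ?len q))"
      using NS TS NT fin by simp
    also have "\<dots> = (\<Sum>q\<in>{q \<in> S. fst q = j}. ?len q)"
      using sum.remove[of "{q \<in> S. fst q = j}" ?P ?len] F(1) P by simp
    finally show ?thesis using F(4) that True by simp
  qed
  show ?thesis
    by (rule feasibleI[OF _ rng disj sum]) (use F(1) in simp)
qed

section \<open>The minimal staircase is non-delay\<close>

text \<open>Tychonoff's theorem, transferred to the topology of the function type.\<close>

lemma compact_bounded_functions: "compact {a :: 'a \<Rightarrow> real. \<forall>x. a x \<in> {0..T}}"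
proof -
  have "compactin (product_topology (\<lambda>i :: 'a. euclidean :: real topology) UNIV) (PiE UNIV (\<lambda>_. {0..T}))"
    by (simp add: compactin_PiE)
  moreover have "PiE UNIV (\<lambda>_. {0..T}) = {a :: 'a \<Rightarrow> real. \<forall>x. a x \<in> {0..T}}"
    by (auto simp: PiE_def Pi_def)
  ultimately show ?thesis by (simp add: euclidean_product_topology)
qed

text \<open>Coordinates are continuous and all conditions are equations or weak inequalities. The
  guards do not depend on \<open>a\<close>, hence are open conditions.\<close>

lemma closed_staircases: "closed {a. staircase n m q a}"
  unfolding staircase_def Ball_def
  by (intro closed_Collect_conj closed_Collect_all closed_Collect_imp open_Collect_const
      closed_Collect_le closed_Collect_eq continuous_on_sum continuous_on_diff continuous_on_const
      continuous_on_product_coordinates)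

text \<open>The movable part may lie anywhere in its job. Its feasible move shows that the job can
  use a slot at \<open>t\<close>; filling that slot from the end of the last piece lowers this
  completion time and leaves the other jobs alone.\<close>

lemma delayed_job_finishes_earlier:
  assumes feas: "feasible n m p S" and pos: "\<And>j. j \<in> {1..n} \<Longrightarrow> 0 < p j"
    and nd: "\<not> non_delay n m p S"
  obtains S' j d where "feasible n m p S'" "j \<in> {1..n}" "0 \<le> d" "d < completion S j"
    "\<And>j' i s e. (j', i, s, e) \<in> S' \<Longrightarrow> e \<le> ((completion S)(j := d)) j'"
proof -
  note F = feasibleD[OF feas]
  from nd obtain i t \<epsilon> j k s e a l where i: "i \<in> {1..m}" and t: "0 \<le> t" and "0 < \<epsilon>"
    and idle: "idle S i {t..<t + \<epsilon>}" and P: "(j, k, s, e) \<in> S" and l: "0 < l" "l \<le> \<epsilon>"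
    and a: "t < a" "s \<le> a" "a + l \<le> e" and mv: "feasible n m p (move S (j, k, s, e) a l i t)"
    unfolding non_delay_def by blast
  let ?M = "move S (j, k, s, e) a l i t"
  let ?C = "completion S j"
  have j: "j \<in> {1..n}" using F(2)[OF P] by simp
  obtain k' s' where Q: "(j, k', s', ?C) \<in> S"
    using completion_attained[where p = p, OF feas j pos[OF j]] by blast
  have s': "s' < ?C" using F(2)[OF Q] by simp
  have eC: "e \<le> ?C" using completion_ge[OF feas P] .
  \<comment> \<open>The bound \<open>l\<close> keeps the slot inside the idle interval,
    \<open>a - t\<close> makes it end by \<open>a\<close>, and halving leaves a non-empty rest of
    the last piece.\<close>
  define \<delta> where "\<delta> = min (min l (a - t)) (?C - s') / 2"
  have \<delta>: "0 < \<delta>" "\<delta> < ?C - s'" "\<delta> \<le> l" "\<delta> \<le> a - t"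
    using l a s' by (auto simp: \<delta>_def)
  have mach: "{u..<v} \<inter> {t..<t + \<epsilon>} = {}" if "(j', i, u, v) \<in> S" for j' u v
    using idle that unfolding idle_def processed_on_def by fastforce
  have notin: "(j', i, t, v) \<notin> S" for j' v
    using mach[of j' t v] F(2)[of j' i t v] \<open>0 < \<epsilon>\<close> by auto
  have job: "{u..<v} \<inter> {t..<t + \<delta>} = {}" if q: "(j, r, u, v) \<in> S" for r u v
  proof -
    have new: "(j, i, t, t + l) \<in> ?M" by simp
    \<comment> \<open>Of the piece being cut, the part before \<open>a\<close> survives the move and
      so misses the slot; the rest starts too late to meet the shorter slot.\<close>
    have "{u..<min v a} \<inter> {t..<t + l} = {}" if "(j, r, u, v) = (j, k, s, e)"
    proof (cases "s < a")
      case True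
      then have "(j, k, s, a) \<in> ?M" by simp
      moreover have "(j, k, s, a) \<noteq> (j, i, t, t + l)" using notin P by auto
      ultimately have "{s..<a} \<inter> {t..<t + l} = {}"
        using feasibleD(3)[OF mv _ new] by blast
      then show ?thesis using that a l by simp
    qed (use that in auto)
    moreover have "{u..<v} \<inter> {t..<t + l} = {}" if "(j, r, u, v) \<noteq> (j, k, s, e)"
    proof -
      have "(j, r, u, v) \<in> ?M" using q that by simp
      moreover have "(j, r, u, v) \<noteq> (j, i, t, t + l)" using notin q by auto
      ultimately show ?thesis using feasibleD(3)[OF mv _ new] by blast
    qed
    moreover have "{u..<v} \<inter> {t..<t + \<delta>} \<subseteq> {u..<min v a} \<inter> {t..<t + l}"
      using \<delta> by auto
    moreover have "{u..<v} \<inter> {t..<t + \<delta>} \<subseteq> {u..<v} \<inter> {t..<t + l}"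
      using \<delta> by auto
    ultimately show ?thesis by blast
  qed
  let ?S' = "insert (j, i, t, t + \<delta>) (insert (j, k', s', ?C - \<delta>) (S - {(j, k', s', ?C)}))"
  have feas': "feasible n m p ?S'"
  proof (rule feasible_shift_tail[OF feas Q \<delta>(1,2) i t job])
    show "{u..<v} \<inter> {t..<t + \<delta>} = {}" if "(j', i, u, v) \<in> S" for j' u v
    proof -
      have "{t..<t + \<delta>} \<subseteq> {t..<t + \<epsilon>}" using \<delta> l by auto
      then show ?thesis using mach[OF that] by blast
    qed
  qed
  have earlier: "v < ?C" if q: "(j, r, u, v) \<in> ?S'" for r u v
  proof -
    consider "v = t + \<delta>" | "v = ?C - \<delta>" | "(j, r, u, v) \<in> S" "(j, r, u, v) \<noteq> (j, k', s', ?C)"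
      using q by auto
    then show ?thesis
    proof cases
      case 3
      then have "{u..<v} \<inter> {s'..<?C} = {}" using F(3)[OF 3(1) Q] by auto
      moreover have "u < v" "v \<le> ?C" using F(2)[OF 3(1)] completion_ge[OF feas 3(1)] by auto
      \<comment> \<open>Two pieces of one job both ending at \<open>?C\<close> would share this
        instant.\<close>
      moreover have "max u s' \<in> {u..<v} \<inter> {s'..<?C}" if "v = ?C"
        using that \<open>u < v\<close> s' by auto
      ultimately show ?thesis by fastforce
    qed (use \<delta> a l eC in auto)
  qed
  show ?thesis
  proof (rule that[OF feas' j])
    show "0 \<le> completion ?S' j"
      using completion_nonneg[where p = p, OF feas' j pos[OF j]] .
    show "completion ?S' j < ?C"
      using completion_attained[where p = p, OF feas' j pos[OF j]] earlier by blast
    show "v \<le> ((completion S)(j := completion ?S' j)) j'" if "(j', r, u, v) \<in> ?S'" for j' r u v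
    proof (cases "j' = j")
      case True
      then show ?thesis using completion_ge[OF feas'] that by simp
    next
      case False
      then have "(j', r, u, v) \<in> S" using that by auto
      then show ?thesis using completion_ge[OF feas] False by simp
    qed
  qed
qed

section \<open>Minimising over the compact set of staircases\<close>

theorem mainTheorem2:
  fixes n m :: nat and p :: "nat \<Rightarrow> real" and f :: "(nat \<Rightarrow> real) \<Rightarrow> real"
  assumes "1 \<le> m"
    and "\<And>j. j \<in> {1..n} \<Longrightarrow> 0 < p j"
    and "regular n f"
    and "\<exists>S. optimal n m p f S"
  shows "\<exists>\<sigma> S. \<sigma> permutes {1..n} \<and> optimal n m p f S \<and>
           non_delay n m p S \<and> pfs_like n (renumber \<sigma> S)"
proof -
  obtain S0 where S0: "optimal n m p f S0" using assms(4) by blast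
  then have feas0: "feasible n m p S0" unfolding optimal_def by simp
  define c where "c = completion S0"
  define T where "T = (\<Sum>j = 1..n. c j)"
  have c0: "0 \<le> c j" if "j \<in> {1..n}" for j
    unfolding c_def using completion_nonneg[where p = p, OF feas0 that assms(2)[OF that]] .
  have cT: "c j \<le> T" if "j \<in> {1..n}" for j
    unfolding T_def by (rule member_le_sum[OF that]) (use c0 in auto)
  have T0: "0 \<le> T" unfolding T_def by (intro sum_nonneg c0)
  \<comment> \<open>The box gives compactness; the bounds by \<open>c\<close> keep every resulting
    schedule optimal, as \<open>f\<close> is regular.\<close>
  define X where "X \<pi> = {a. \<forall>x. a x \<in> {0..T}} \<inter> {a. staircase n m (\<lambda>j. p (\<pi> j)) a} \<inter>
    {a :: nat \<times> nat \<Rightarrow> real. \<forall>j < n. a (1, Suc j) \<le> c (\<pi> (Suc j))}" for \<pi> :: "nat \<Rightarrow> nat"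
  \<comment> \<open>All numberings compete, because lowering one completion time can change the
    sorted order. There are finitely many, so compactness survives the union.\<close>
  define Y where "Y = (\<Union>\<pi> \<in> {\<pi>. \<pi> permutes {1..n}}. X \<pi>)"
  let ?cost = "\<lambda>a :: nat \<times> nat \<Rightarrow> real. \<Sum>j < n. a (1, Suc j)"
  have "compact (X \<pi>)" for \<pi>
    unfolding X_def
    by (intro compact_Int_closed compact_bounded_functions closed_staircases closed_Collect_all
        closed_Collect_imp open_Collect_const closed_Collect_le continuous_on_const
        continuous_on_product_coordinates)
  then have "compact Y"
    unfolding Y_def by (intro compact_UN finite_permutations) auto
  \<comment> \<open>Used twice: with \<open>d = c\<close> it shows that \<open>Y\<close> is
    non-empty, and with one completion time lowered it contradicts minimality.\<close>
  have improve: "\<exists>a \<in> Y. ?cost a \<le> (\<Sum>j = 1..n. d j)"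
    if feas: "feasible n m p S" and ends: "\<And>j i s e. (j, i, s, e) \<in> S \<Longrightarrow> e \<le> d j"
      and d: "\<And>j. j \<in> {1..n} \<Longrightarrow> 0 \<le> d j \<and> d j \<le> c j" for S d
  proof -
    obtain \<pi> where \<pi>: "\<pi> permutes {1..n}"
      and sorted: "\<And>i j. 1 \<le> i \<Longrightarrow> i \<le> j \<Longrightarrow> j \<le> n \<Longrightarrow> d (\<pi> i) \<le> d (\<pi> j)"
      using sorting_permutation by blast
    have d0: "\<And>j. j \<in> {1..n} \<Longrightarrow> 0 \<le> d j" using d by blast
    obtain a where a: "staircase n m (\<lambda>j. p (\<pi> j)) a"
      "\<And>j. j < n \<Longrightarrow> a (1, Suc j) \<le> d (\<pi> (Suc j))" "\<And>i j. i \<notin> {1..m} \<or> n < j \<Longrightarrow> a (i, j) = 0"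
    proof (rule feasible_imp_staircase[OF feas \<pi>, of d])
      show "e \<le> d j" if "(j, i, s, e) \<in> S" for j i s e using ends[OF that] .
      show "0 \<le> d j" if "j \<in> {1..n}" for j using d0[OF that] .
      show "d (\<pi> i) \<le> d (\<pi> j)" if "1 \<le> i" "i \<le> j" "j \<le> n" for i j using sorted[OF that] .
    next
      fix a
      assume "staircase n m (\<lambda>j. p (\<pi> j)) a" "\<And>j. j < n \<Longrightarrow> a (1, Suc j) \<le> d (\<pi> (Suc j))"
        "\<And>i j. i \<notin> {1..m} \<or> n < j \<Longrightarrow> a (i, j) = 0"
      then show thesis by (rule that)
    qed
    have \<pi>S: "\<pi> (Suc j) \<in> {1..n}" if "j < n" for j
      using permutes_in_image[OF \<pi>, of "Suc j"] that by simp
    have le: "a (1, Suc j) \<le> c (\<pi> (Suc j))" if "j < n" for j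
      using a(2)[OF that] d \<pi>S[OF that] by (meson order_trans)
    \<comment> \<open>On the grid machine 1 has the largest mark, which is at most some
      \<open>c j\<close>; elsewhere the array is 0.\<close>
    have bound: "a (i, j) \<in> {0..T}" for i j
    proof (cases "i \<in> {1..m} \<and> j \<le> n \<and> j \<noteq> 0")
      case True
      then obtain k where k: "j = Suc k" "k < n" by (cases j) auto
      have "a (i, Suc k) \<le> a (1, Suc k)"
        using staircase_next_job[OF a(1), of 1 i k] staircase_mono[OF a(1), of 1 k "Suc k"] True k
        by (cases "i = 1") force+
      then show ?thesis
        using le[OF k(2)] cT[OF \<pi>S[OF k(2)]] staircase_nonneg[OF a(1), of i j] True k by auto
    next
      case False
      then have "a (i, j) = 0"
        using a(1,3) unfolding staircase_def by (cases "i \<in> {1..m}") auto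
      then show ?thesis using T0 by simp
    qed
    have "?cost a \<le> (\<Sum>j < n. d (\<pi> (Suc j)))" by (intro sum_mono a(2)) simp
    also have "\<dots> = (\<Sum>j = 1..n. d (\<pi> j))"
      by (rule sum.reindex_bij_witness[of _ "\<lambda>j. j - 1" Suc]) auto
    also have "\<dots> = (\<Sum>j = 1..n. d j)"
      using sum.permute[OF \<pi>, of d] by (simp add: comp_def)
    finally have "?cost a \<le> (\<Sum>j = 1..n. d j)" .
    moreover have "a \<in> Y"
      unfolding Y_def X_def using a(1) \<pi> bound le by auto
    ultimately show ?thesis by blast
  qed
  have "Y \<noteq> {}"
    using improve[OF feas0, of c] completion_ge[OF feas0] c0 unfolding c_def by blast
  moreover have "continuous_on Y ?cost"
    by (intro continuous_on_sum) (rule continuous_on_subset[OF continuous_on_product_coordinates], simp)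
  ultimately obtain a where "a \<in> Y" and min: "\<And>b. b \<in> Y \<Longrightarrow> ?cost a \<le> ?cost b"
    using continuous_attains_inf[OF \<open>compact Y\<close>, of ?cost] by blast
  then obtain \<pi> where \<pi>: "\<pi> permutes {1..n}" and st: "staircase n m (\<lambda>j. p (\<pi> j)) a"
    and ac: "\<And>j. j < n \<Longrightarrow> a (1, Suc j) \<le> c (\<pi> (Suc j))"
    unfolding Y_def X_def by blast
  define S where "S = stair_schedule n m \<pi> a"
  have feas: "feasible n m p S"
    unfolding S_def by (rule stair_schedule_feasible[OF st \<pi>])
  have \<pi>_Suc: "\<exists>k < n. j = \<pi> (Suc k)" if "j \<in> {1..n}" for j
  proof -
    have "j \<in> \<pi> ` {1..n}" using permutes_image[OF \<pi>] that by simp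
    then obtain i where "i \<in> {1..n}" "j = \<pi> i" by blast
    then show ?thesis by (intro exI[of _ "i - 1"]) auto
  qed
  have Ca: "completion S (\<pi> (Suc k)) \<le> a (1, Suc k)" if "k < n" for k
  proof -
    have "\<pi> (Suc k) \<in> {1..n}" using permutes_in_image[OF \<pi>, of "Suc k"] that by simp
    from completion_attained[where p = p, OF feas this assms(2)[OF this]]
    obtain i s where "(\<pi> (Suc k), i, s, completion S (\<pi> (Suc k))) \<in> S" .
    then show ?thesis
      using stair_schedule_end_le[OF st _ permutes_inj[OF \<pi>] refl] unfolding S_def by simp
  qed
  have C0: "0 \<le> completion S j" if "j \<in> {1..n}" for j
    using completion_nonneg[where p = p, OF feas that assms(2)[OF that]] .
  have Cc: "completion S j \<le> c j" if "j \<in> {1..n}" for j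
    using \<pi>_Suc[OF that] Ca ac by (metis order_trans)
  have "optimal n m p f S"
  proof -
    have "f (completion S) \<le> f c"
      using assms(3) C0 Cc unfolding regular_def by blast
    then show ?thesis
      using S0 feas unfolding optimal_def c_def by (meson order_trans)
  qed
  moreover have "non_delay n m p S"
  proof (rule ccontr)
    assume nd: "\<not> non_delay n m p S"
    obtain S' j d where S': "feasible n m p S'" "j \<in> {1..n}" "0 \<le> d" "d < completion S j"
      and ends: "\<And>j' i s e. (j', i, s, e) \<in> S' \<Longrightarrow> e \<le> ((completion S)(j := d)) j'"
      using delayed_job_finishes_earlier[where p = p, OF feas assms(2) nd] by metis
    let ?d = "(completion S)(j := d)"
    have d: "0 \<le> ?d j' \<and> ?d j' \<le> c j'" if "j' \<in> {1..n}" for j'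
      using C0[OF that] Cc[OF that] S'(3,4) by auto
    have "\<exists>b \<in> Y. ?cost b \<le> (\<Sum>j' = 1..n. ?d j')"
    proof (rule improve[OF S'(1)])
      show "e \<le> ?d j'" if "(j', i, s, e) \<in> S'" for j' i s e using ends[OF that] .
      show "0 \<le> ?d j' \<and> ?d j' \<le> c j'" if "j' \<in> {1..n}" for j' using d[OF that] .
    qed
    then obtain b where "b \<in> Y" "?cost b \<le> (\<Sum>j' = 1..n. ?d j')" by blast
    \<comment> \<open>The cost of \<open>a\<close> is at least the total completion time of
      \<open>S\<close>, which strictly exceeds the total of \<open>?d\<close>, and that is at least
      the cost of \<open>b\<close>.\<close>
    then have "?cost a \<le> (\<Sum>j' = 1..n. ?d j')" using min by (meson order_trans)
    also have "\<dots> < (\<Sum>j' = 1..n. completion S j')"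
      by (rule sum_strict_mono_ex1) (use S' in auto)
    also have "\<dots> = (\<Sum>j' = 1..n. completion S (\<pi> j'))"
      using sum.permute[OF \<pi>, of "completion S"] by (simp add: comp_def)
    also have "\<dots> = (\<Sum>k < n. completion S (\<pi> (Suc k)))"
      by (rule sum.reindex_bij_witness[of _ Suc "\<lambda>j. j - 1"]) auto
    also have "\<dots> \<le> ?cost a" by (intro sum_mono Ca) simp
    finally show False by simp
  qed
  moreover have "pfs_like n (renumber (inv \<pi>) S)"
    unfolding S_def renumber_stair_schedule[OF \<pi>] by (rule stair_schedule_pfs_like[OF st])
  ultimately show ?thesis using permutes_inv[OF \<pi>] by blast
qed

end
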